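(* Let $(\mathfrak g,\omega)$ be a symplectic Lie algebra. Then all irreducible symplectic bases of $(\mathfrak g,\omega)$ are isomorphic as symplectic Lie algebras. That is, if $(\mathfrak b,\omega_{\mathfrak b})$ and $(\mathfrak b',\omega_{\mathfrak b'})$ are irreducible symplectic Lie algebras, each of which is the last term of some (finite) sequence of subsequent symplectic reductions starting with $(\mathfrak g,\omega)$, then there is a Lie algebra isomorphism $\Phi:\mathfrak b\to\mathfrak b'$ with $\Phi^*\omega_{\mathfrak b'}=\omega_{\mathfrak b}$.
   Context: All Lie algebras are finite-dimensional over a fixed field $k$ of characteristic $0$. A symplectic Lie algebra $(\mathfrak g,\omega)$ is a Lie algebra $\mathfrak g$ with a non-degenerate alternating form $\omega$ satisfying $\omega([u,v],w)+\omega([w,u],v)+\omega([v,w],u)=0$ for all $u,v,w$. For a subspace $W$, $W^{\perp_\omega}=\{v:\omega(v,w)=0\ \forall w\in W\}$; $W$ is isotropic if $W\subseteq W^{\perp_\omega}$. If $\mathfrak j$ is an isotropic ideal of $(\mathfrak g,\omega)$ (an ideal of $\mathfrak g$ that is an isotropic subspace), then $\mathfrak j^{\perp_\omega}$ is a subalgebra containing $\mathfrak j$ as an ideal, and $\omega$ induces a symplectic form $\bar\omega$ on the quotient Lie algebra $\bar{\mathfrak g}=\mathfrak j^{\perp_\omega}/\mathfrak j$. The symplectic Lie algebra $(\bar{\mathfrak g},\bar\omega)$ is the symplectic reduction of $(\mathfrak g,\omega)$ with respect to $\mathfrak j$. A reduction sequence of length $\ell\ge 0$ is a sequence $(\mathfrak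 g,\omega),(\mathfrak g_1,\omega_1),\dots,(\mathfrak g_\ell,\omega_\ell)$ in which each term is a symplectic reduction of the preceding one; its last term is called its base. A symplectic Lie algebra is irreducible if it has no non-zero isotropic ideal. An irreducible symplectic base of $(\mathfrak g,\omega)$ is an irreducible symplectic Lie algebra occurring as the base of a reduction sequence starting with $(\mathfrak g,\omega)$. *)

theory Defs
  imports "HOL-Algebra.QuotRing" "Jordan_Normal_Form.Missing_VectorSpace"
begin

text \<open>
  Vector spaces are those of the AFP entry VectorSpace. Its record type extends that of rings;
  the fields \<open>mult\<close> and \<open>one\<close> of the space of vectors are not used anywhere.
\<close>

record ('k, 'a) lie_alg = "('k, 'a) module" +
  bracket :: "'a \<Rightarrow> 'a \<Rightarrow> 'a"

record ('k, 'a) symp_alg = "('k, 'a) lie_alg" +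
  form :: "'a \<Rightarrow> 'a \<Rightarrow> 'k"

locale char_zero_field = field K for K (structure) +
  assumes char_zero: "(n::nat) > 0 \<Longrightarrow> [n] \<cdot> \<one> \<noteq> \<zero>"

locale lie_algebra = vectorspace K L + char_zero_field K
  for K :: "('k, 'm) ring_scheme" (structure) and L :: "('k, 'a, 'n) lie_alg_scheme" (structure) +
  assumes finite_dim: "fin_dim"
    and bracket_closed: "\<lbrakk>x \<in> carrier L; y \<in> carrier L\<rbrakk> \<Longrightarrow> bracket L x y \<in> carrier L"
    and bracket_add_left: "\<lbrakk>x \<in> carrier L; y \<in> carrier L; z \<in> carrier L\<rbrakk> \<Longrightarrow>
      bracket L (x \<oplus>\<^bsub>L\<^esub> y) z = bracket L x z \<oplus>\<^bsub>L\<^esub> bracket L y z"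
    and bracket_add_right: "\<lbrakk>x \<in> carrier L; y \<in> carrier L; z \<in> carrier L\<rbrakk> \<Longrightarrow>
      bracket L x (y \<oplus>\<^bsub>L\<^esub> z) = bracket L x y \<oplus>\<^bsub>L\<^esub> bracket L x z"
    and bracket_smult_left: "\<lbrakk>a \<in> carrier K; x \<in> carrier L; y \<in> carrier L\<rbrakk> \<Longrightarrow>
      bracket L (a \<odot>\<^bsub>L\<^esub> x) y = a \<odot>\<^bsub>L\<^esub> bracket L x y"
    and bracket_smult_right: "\<lbrakk>a \<in> carrier K; x \<in> carrier L; y \<in> carrier L\<rbrakk> \<Longrightarrow>
      bracket L x (a \<odot>\<^bsub>L\<^esub> y) = a \<odot>\<^bsub>L\<^esub> bracket L x y"
    and bracket_self: "x \<in> carrier L \<Longrightarrow> bracket L x x = \<zero>\<^bsub>L\<^esub>"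
    and jacobi: "\<lbrakk>x \<in> carrier L; y \<in> carrier L; z \<in> carrier L\<rbrakk> \<Longrightarrow>
      bracket L x (bracket L y z) \<oplus>\<^bsub>L\<^esub> bracket L y (bracket L z x)
        \<oplus>\<^bsub>L\<^esub> bracket L z (bracket L x y) = \<zero>\<^bsub>L\<^esub>"

locale symplectic_lie_algebra = lie_algebra K G
  for K :: "('k, 'm) ring_scheme" (structure) and G :: "('k, 'a, 'n) symp_alg_scheme" (structure) +
  assumes form_closed: "\<lbrakk>u \<in> carrier G; v \<in> carrier G\<rbrakk> \<Longrightarrow> form G u v \<in> carrier K"
    and form_add_left: "\<lbrakk>u \<in> carrier G; v \<in> carrier G; w \<in> carrier G\<rbrakk> \<Longrightarrow>
      form G (u \<oplus>\<^bsub>G\<^esub> v) w = form G u w \<oplus>\<^bsub>K\<^esub> form G v w"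
    and form_add_right: "\<lbrakk>u \<in> carrier G; v \<in> carrier G; w \<in> carrier G\<rbrakk> \<Longrightarrow>
      form G u (v \<oplus>\<^bsub>G\<^esub> w) = form G u v \<oplus>\<^bsub>K\<^esub> form G u w"
    and form_smult_left: "\<lbrakk>a \<in> carrier K; u \<in> carrier G; v \<in> carrier G\<rbrakk> \<Longrightarrow>
      form G (a \<odot>\<^bsub>G\<^esub> u) v = a \<otimes>\<^bsub>K\<^esub> form G u v"
    and form_smult_right: "\<lbrakk>a \<in> carrier K; u \<in> carrier G; v \<in> carrier G\<rbrakk> \<Longrightarrow>
      form G u (a \<odot>\<^bsub>G\<^esub> v) = a \<otimes>\<^bsub>K\<^esub> form G u v"
    and form_self: "u \<in> carrier G \<Longrightarrow> form G u u = \<zero>\<^bsub>K\<^esub>"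
    and form_nondegenerate:
      "\<lbrakk>u \<in> carrier G; \<And>v. v \<in> carrier G \<Longrightarrow> form G u v = \<zero>\<^bsub>K\<^esub>\<rbrakk> \<Longrightarrow> u = \<zero>\<^bsub>G\<^esub>"
    and form_closed_cocycle: "\<lbrakk>u \<in> carrier G; v \<in> carrier G; w \<in> carrier G\<rbrakk> \<Longrightarrow>
      form G (bracket G u v) w \<oplus>\<^bsub>K\<^esub> form G (bracket G w u) v \<oplus>\<^bsub>K\<^esub> form G (bracket G v w) u = \<zero>\<^bsub>K\<^esub>"

definition lie_ideal ::
    "('k, 'm) ring_scheme \<Rightarrow> ('k, 'a, 'n) lie_alg_scheme \<Rightarrow> 'a set \<Rightarrow> bool" where
  "lie_ideal K L J \<longleftrightarrow>
     subspace K J L \<and> (\<forall>x \<in> carrier L. \<forall>y \<in> J. bracket L x y \<in> J)"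

definition perp ::
    "('k, 'm) ring_scheme \<Rightarrow> ('k, 'a, 'n) symp_alg_scheme \<Rightarrow> 'a set \<Rightarrow> 'a set" where
  "perp K G W = {v \<in> carrier G. \<forall>w \<in> W. form G v w = \<zero>\<^bsub>K\<^esub>}"

definition isotropic_ideal ::
    "('k, 'm) ring_scheme \<Rightarrow> ('k, 'a, 'n) symp_alg_scheme \<Rightarrow> 'a set \<Rightarrow> bool" where
  "isotropic_ideal K G J \<longleftrightarrow> lie_ideal K G J \<and> J \<subseteq> perp K G J"

definition irreducible_symplectic ::
    "('k, 'm) ring_scheme \<Rightarrow> ('k, 'a, 'n) symp_alg_scheme \<Rightarrow> bool" where
  "irreducible_symplectic K G \<longleftrightarrow>
     symplectic_lie_algebra K G \<and> (\<forall>J. isotropic_ideal K G J \<longrightarrow> J = {\<zero>\<^bsub>G\<^esub>})"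

text \<open>
  The quotient of \<open>perp K G J\<close> by \<open>J\<close>, with cosets as elements. Operations on cosets are
  written as unions over all representatives, as in \<^const>\<open>rcoset_mult\<close>.
\<close>

definition symplectic_reduction ::
    "('k, 'm) ring_scheme \<Rightarrow> ('k, 'a, 'n) symp_alg_scheme \<Rightarrow> 'a set \<Rightarrow> ('k, 'a set) symp_alg" where
  "symplectic_reduction K G J =
     \<lparr>carrier = (\<lambda>v. J +>\<^bsub>G\<^esub> v) ` perp K G J,
      mult = undefined,
      one = undefined,
      zero = J,
      add = set_add G,
      smult = (\<lambda>a X. \<Union>x \<in> X. J +>\<^bsub>G\<^esub> (a \<odot>\<^bsub>G\<^esub> x)),
      bracket = (\<lambda>X Y. \<Union>x \<in> X. \<Union>y \<in> Y. J +>\<^bsub>G\<^esub> bracket G x y),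
      form = (\<lambda>X Y. THE c. \<forall>x \<in> X. \<forall>y \<in> Y. form G x y = c)\<rparr>"

definition symplectic_iso ::
    "('k, 'm) ring_scheme \<Rightarrow> ('k, 'a, 'n) symp_alg_scheme \<Rightarrow> ('k, 'b, 'p) symp_alg_scheme \<Rightarrow>
      ('a \<Rightarrow> 'b) \<Rightarrow> bool" where
  "symplectic_iso K G H \<Phi> \<longleftrightarrow>
     \<Phi> \<in> module_hom K G H \<and> bij_betw \<Phi> (carrier G) (carrier H) \<and>
     (\<forall>x \<in> carrier G. \<forall>y \<in> carrier G. \<Phi> (bracket G x y) = bracket H (\<Phi> x) (\<Phi> y)) \<and>
     (\<forall>x \<in> carrier G. \<forall>y \<in> carrier G. form H (\<Phi> x) (\<Phi> y) = form G x y)"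

lemma reduction_ops:
  assumes "symplectic_lie_algebra K G" and J: "isotropic_ideal K G J"
    and v: "v \<in> perp K G J" and w: "w \<in> perp K G J" and a: "a \<in> carrier K"
  defines "q \<equiv> (\<lambda>x. J +>\<^bsub>G\<^esub> x)"
  shows "q v \<oplus>\<^bsub>symplectic_reduction K G J\<^esub> q w = q (v \<oplus>\<^bsub>G\<^esub> w)"
    and "a \<odot>\<^bsub>symplectic_reduction K G J\<^esub> q v = q (a \<odot>\<^bsub>G\<^esub> v)"
    and "bracket (symplectic_reduction K G J) (q v) (q w) = q (bracket G v w)"
    and "form (symplectic_reduction K G J) (q v) (q w) = form G v w"
    and "v \<oplus>\<^bsub>G\<^esub> w \<in> perp K G J"
    and "a \<odot>\<^bsub>G\<^esub> v \<in> perp K G J"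
    and "bracket G v w \<in> perp K G J"
proof -
  interpret S: symplectic_lie_algebra K G by fact
  have sub: "submodule K J G" and ideal: "\<And>x y. \<lbrakk>x \<in> carrier G; y \<in> J\<rbrakk> \<Longrightarrow> bracket G x y \<in> J"
    and iso: "J \<subseteq> perp K G J"
    using J by (auto simp: isotropic_ideal_def lie_ideal_def subspace_def)
  interpret N: submodule K J G by (rule sub)
  have JG: "x \<in> carrier G" if "x \<in> J" for x
    using N.subset that by blast
  have neg: "\<ominus>\<^bsub>G\<^esub> x \<in> J" if "x \<in> J" for x
    using that N.smult_closed[of "\<ominus>\<^bsub>K\<^esub> \<one>\<^bsub>K\<^esub>" x] JG S.smult_minus_1[of x] by auto
  have "subgroup J (add_monoid G)"
    using neg JG by (intro S.M.add.subgroupI) (auto simp: a_inv_def[symmetric] intro: N.zero_closed)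
  then interpret A: abelian_subgroup J G
    by (intro abelian_subgroupI2 S.M.a_comm_group)
  have q_mem: "\<exists>j\<in>J. x = j \<oplus>\<^bsub>G\<^esub> y" if "x \<in> q y" for x y
    using that by (auto simp: q_def a_r_coset_def r_coset_def)
  have q_self: "y \<in> q y" if "y \<in> carrier G" for y
    using that A.a_rcos_self by (simp add: q_def)
  have q_add: "q (j \<oplus>\<^bsub>G\<^esub> y) = q y" if "j \<in> J" "y \<in> carrier G" for j y
    using A.a_repr_independence'[of "j \<oplus>\<^bsub>G\<^esub> y" y] that
    by (force simp: q_def a_r_coset_def r_coset_def)
  have vG: "v \<in> carrier G" and wG: "w \<in> carrier G"
    and vJ: "\<And>j. j \<in> J \<Longrightarrow> form G v j = \<zero>\<^bsub>K\<^esub>" and wJ: "\<And>j. j \<in> J \<Longrightarrow> form G w j = \<zero>\<^bsub>K\<^esub>"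
    using v w by (auto simp: perp_def)
  have skew: "form G x y = \<ominus>\<^bsub>K\<^esub> form G y x" if "x \<in> carrier G" "y \<in> carrier G" for x y
  proof -
    have "\<zero>\<^bsub>K\<^esub> = form G (x \<oplus>\<^bsub>G\<^esub> y) (x \<oplus>\<^bsub>G\<^esub> y)"
      using that by (simp add: S.form_self)
    also have "\<dots> = form G x y \<oplus>\<^bsub>K\<^esub> form G y x"
      using that by (simp add: S.form_add_left S.form_add_right S.form_closed S.R.a_comm S.form_self[OF that(1)] S.form_self[OF that(2)])
    finally show ?thesis
      using that S.form_closed by (metis S.R.minus_equality)
  qed
  have Jv: "form G j v = \<zero>\<^bsub>K\<^esub>" and Jw: "form G j w = \<zero>\<^bsub>K\<^esub>" if "j \<in> J" for j
    using skew[OF JG[OF that] vG] skew[OF JG[OF that] wG] vJ[OF that] wJ[OF that] by auto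
  have bracket_skew: "bracket G x y = \<ominus>\<^bsub>G\<^esub> bracket G y x"
    if "x \<in> carrier G" "y \<in> carrier G" for x y
  proof -
    have "\<zero>\<^bsub>G\<^esub> = bracket G (x \<oplus>\<^bsub>G\<^esub> y) (x \<oplus>\<^bsub>G\<^esub> y)"
      using that by (simp add: S.bracket_self)
    also have "\<dots> = bracket G x y \<oplus>\<^bsub>G\<^esub> bracket G y x"
      using that by (simp add: S.bracket_add_left S.bracket_add_right S.bracket_closed S.M.a_comm S.bracket_self[OF that(1)] S.bracket_self[OF that(2)])
    finally show ?thesis
      using that S.bracket_closed by (metis S.M.minus_equality)
  qed
  have ideal': "bracket G y x \<in> J" if "x \<in> carrier G" "y \<in> J" for x y
    using bracket_skew[OF JG[OF that(2)] that(1)] neg[OF ideal[OF that]] by simp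
  show "q v \<oplus>\<^bsub>symplectic_reduction K G J\<^esub> q w = q (v \<oplus>\<^bsub>G\<^esub> w)"
    using A.a_rcos_sum vG wG by (simp add: symplectic_reduction_def q_def)
  have "q (a \<odot>\<^bsub>G\<^esub> x) = q (a \<odot>\<^bsub>G\<^esub> v)" if "x \<in> q v" for x
    using q_mem[OF that] a vG JG by (auto simp: S.smult_r_distr q_add)
  then have "(\<Union>x \<in> q v. q (a \<odot>\<^bsub>G\<^esub> x)) = q (a \<odot>\<^bsub>G\<^esub> v)"
    using q_self[OF vG] by (intro SUP_eq_const) blast+
  then show "a \<odot>\<^bsub>symplectic_reduction K G J\<^esub> q v = q (a \<odot>\<^bsub>G\<^esub> v)"
    by (simp add: symplectic_reduction_def q_def)
  have qbr: "q (bracket G x y) = q (bracket G v w)" if x: "x \<in> q v" and y: "y \<in> q w" for x y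
  proof -
    obtain j l where j: "j \<in> J" "x = j \<oplus>\<^bsub>G\<^esub> v" and l: "l \<in> J" "y = l \<oplus>\<^bsub>G\<^esub> w"
      using q_mem[OF x] q_mem[OF y] by blast
    have y: "y \<in> carrier G"
      using l JG wG by simp
    then have "bracket G x y = bracket G j y \<oplus>\<^bsub>G\<^esub> bracket G v y"
      using j(1) JG vG by (simp add: S.bracket_add_left j(2))
    moreover have "bracket G v y = bracket G v l \<oplus>\<^bsub>G\<^esub> bracket G v w"
      using l JG vG wG by (simp add: S.bracket_add_right)
    ultimately show ?thesis
      using j(1) l(1) y JG vG wG ideal ideal' S.bracket_closed by (simp add: q_add)
  qed
  have "q v \<noteq> {}" and "q w \<noteq> {}"
    using q_self[OF vG] q_self[OF wG] by blast+
  have "(\<Union>y \<in> q w. q (bracket G x y)) = q (bracket G v w)" if "x \<in> q v" for x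
    by (rule SUP_eq_const[OF \<open>q w \<noteq> {}\<close>]) (rule qbr[OF that])
  then have "(\<Union>x \<in> q v. \<Union>y \<in> q w. q (bracket G x y)) = q (bracket G v w)"
    by (rule SUP_eq_const[OF \<open>q v \<noteq> {}\<close>])
  then show "bracket (symplectic_reduction K G J) (q v) (q w) = q (bracket G v w)"
    by (simp add: symplectic_reduction_def q_def)
  have fm: "form G x y = form G v w" if x: "x \<in> q v" and y: "y \<in> q w" for x y
  proof -
    obtain j l where j: "j \<in> J" "x = j \<oplus>\<^bsub>G\<^esub> v" and l: "l \<in> J" "y = l \<oplus>\<^bsub>G\<^esub> w"
      using q_mem[OF x] q_mem[OF y] by blast
    have "form G j l = \<zero>\<^bsub>K\<^esub>"
      using iso j l by (auto simp: perp_def)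
    then show ?thesis
      using JG[OF j(1)] JG[OF l(1)] vG wG vJ[OF l(1)] Jw[OF j(1)]
      by (simp add: j(2) l(2) S.form_closed S.form_add_left S.form_add_right)
  qed
  have "(THE c. \<forall>x \<in> q v. \<forall>y \<in> q w. form G x y = c) = form G v w"
  proof (rule the_equality)
    show "\<forall>x \<in> q v. \<forall>y \<in> q w. form G x y = form G v w"
      by (intro ballI fm)
    show "c = form G v w" if "\<forall>x \<in> q v. \<forall>y \<in> q w. form G x y = c" for c
      using bspec[OF bspec[OF that q_self[OF vG]] q_self[OF wG]] by (rule sym)
  qed
  then show "form (symplectic_reduction K G J) (q v) (q w) = form G v w"
    by (simp add: symplectic_reduction_def q_def)
  show "v \<oplus>\<^bsub>G\<^esub> w \<in> perp K G J" and "a \<odot>\<^bsub>G\<^esub> v \<in> perp K G J"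
    using vG wG a JG vJ wJ by (auto simp: perp_def S.form_add_left S.form_smult_left)
  have "form G (bracket G v w) j = \<zero>\<^bsub>K\<^esub>" if j: "j \<in> J" for j
  proof -
    have "form G (bracket G j v) w = \<zero>\<^bsub>K\<^esub>" "form G (bracket G w j) v = \<zero>\<^bsub>K\<^esub>"
      using Jw[OF ideal'[OF vG j]] Jv[OF ideal[OF wG j]] by simp_all
    then show ?thesis
      using S.form_closed_cocycle[OF vG wG JG[OF j]] S.form_closed S.bracket_closed vG wG JG[OF j]
      by auto
  qed
  then show "bracket G v w \<in> perp K G J"
    using vG wG S.bracket_closed by (auto simp: perp_def)
qed

text \<open>
  Cosets of elements of type \<open>'a\<close> have type \<open>'a set\<close>, so the terms of a literal reduction sequence
  would have pairwise different types. Every term is therefore carried back to a set of elements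
  of type \<open>'a\<close> along an isomorphism with the literal quotient. The lemma
  \<open>reduction_copy_exists\<close> below shows that no reduction is lost in this way.
\<close>

definition is_symplectic_reduction ::
    "('k, 'm) ring_scheme \<Rightarrow> ('k, 'a) symp_alg \<Rightarrow> ('k, 'a) symp_alg \<Rightarrow> bool" where
  "is_symplectic_reduction K G H \<longleftrightarrow>
     (\<exists>J \<Phi>. isotropic_ideal K G J \<and> symplectic_iso K (symplectic_reduction K G J) H \<Phi>)"

text \<open>A sequence of length \<open>l\<close> is a list with \<open>l + 1\<close> entries.\<close>

definition reduction_sequence ::
    "('k, 'm) ring_scheme \<Rightarrow> ('k, 'a) symp_alg list \<Rightarrow> bool" where
  "reduction_sequence K Gs \<longleftrightarrow>
     Gs \<noteq> [] \<and> (\<forall>G \<in> set Gs. symplectic_lie_algebra K G) \<and>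
     successively (is_symplectic_reduction K) Gs"

definition irreducible_symplectic_base ::
    "('k, 'm) ring_scheme \<Rightarrow> ('k, 'a) symp_alg \<Rightarrow> ('k, 'a) symp_alg \<Rightarrow> bool" where
  "irreducible_symplectic_base K G B \<longleftrightarrow>
     irreducible_symplectic K B \<and>
     (\<exists>Gs. reduction_sequence K Gs \<and> hd Gs = G \<and> last Gs = B)"

lemma reduction_copy_exists:
  fixes G :: "('k, 'a) symp_alg"
  assumes "symplectic_lie_algebra K G" and "isotropic_ideal K G J"
  shows "\<exists>H. is_symplectic_reduction K G H \<and>
    (\<exists>\<Phi>. symplectic_iso K (symplectic_reduction K G J) H \<Phi>)"
proof -
  let ?Q = "symplectic_reduction K G J"
  let ?q = "\<lambda>v. J +>\<^bsub>G\<^esub> v"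
  have carr: "carrier ?Q = ?q ` perp K G J"
    by (simp add: symplectic_reduction_def)
  interpret S: symplectic_lie_algebra K G by fact
  note ops = reduction_ops[OF assms]
  have closed:
      "\<And>X Y. \<lbrakk>X \<in> carrier ?Q; Y \<in> carrier ?Q\<rbrakk> \<Longrightarrow> X \<oplus>\<^bsub>?Q\<^esub> Y \<in> carrier ?Q"
      "\<And>a X. \<lbrakk>a \<in> carrier K; X \<in> carrier ?Q\<rbrakk> \<Longrightarrow> a \<odot>\<^bsub>?Q\<^esub> X \<in> carrier ?Q"
      "\<And>X Y. \<lbrakk>X \<in> carrier ?Q; Y \<in> carrier ?Q\<rbrakk> \<Longrightarrow> bracket ?Q X Y \<in> carrier ?Q"
    using ops ops[where a = "\<zero>\<^bsub>K\<^esub>"] by (auto simp: carr)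
  define r where "r X = (SOME v. v \<in> perp K G J \<and> ?q v = X)" for X
  have qr: "?q (r X) = X" if "X \<in> carrier ?Q" for X
  proof -
    from that have "\<exists>v. v \<in> perp K G J \<and> ?q v = X"
      by (auto simp: carr)
    from someI_ex[OF this] show ?thesis by (simp add: r_def)
  qed
  define H :: "('k, 'a) symp_alg" where
    "H = \<lparr>carrier = r ` carrier ?Q, mult = undefined, one = undefined, zero = r \<zero>\<^bsub>?Q\<^esub>,
          add = (\<lambda>x y. r (?q x \<oplus>\<^bsub>?Q\<^esub> ?q y)), smult = (\<lambda>a x. r (a \<odot>\<^bsub>?Q\<^esub> ?q x)),
          bracket = (\<lambda>x y. r (bracket ?Q (?q x) (?q y))), form = (\<lambda>x y. form ?Q (?q x) (?q y))\<rparr>"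
  have "inj_on r (carrier ?Q)" by (metis inj_onI qr)
  then have "symplectic_iso K ?Q H r"
    using qr closed by (auto simp: symplectic_iso_def H_def module_hom_def bij_betw_def)
  then show ?thesis
    using assms(2) by (auto simp: is_symplectic_reduction_def)
qed

end

theory Submission
  imports Defs "HOL-Library.Confluence"
begin

text \<open>
  One-step reductions have the diamond property, by a symplectic version of Zassenhaus' butterfly:
  for isotropic ideals \<open>I\<close> and \<open>J\<close>, the image of \<open>J \<inter> I\<^sup>\<bottom>\<close> in
  \<open>I\<^sup>\<bottom> / I\<close> is an isotropic ideal, and reducing by it gives
  \<open>(I\<^sup>\<bottom> \<inter> J\<^sup>\<bottom>) / (I \<inter> J\<^sup>\<bottom> + J \<inter> I\<^sup>\<bottom>)\<close>, which is symmetric in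
  \<open>I\<close> and \<open>J\<close>. Hence reduction is confluent; and an irreducible algebra reduces only to
  isomorphic copies of itself.
\<close>

section \<open>Linear algebra: dimension of subspaces and orthogonal complements\<close>

text \<open>Independence in \<open>W\<close> implies independence in \<open>V\<close>, so
  \<open>dim\<close> bounds the size of independent subsets of \<open>W\<close>; a maximal one
  generates \<open>W\<close>.\<close>

lemma (in vectorspace) subspace_fin_dim:
  assumes "fin_dim" and W: "subspace K W V"
  shows "vectorspace.fin_dim K (vs W)"
proof -
  interpret W: vectorspace K "vs W"
    using W by (rule subspace_is_vs)
  have sub: "submodule K W V" and WV: "W \<subseteq> carrier V"
    using W by (auto simp: subspace_def submodule_def)
  let ?P = "\<lambda>S. S \<subseteq> carrier (vs W) \<and> W.lin_indpt S"
  have "finite S \<and> card S \<le> dim" if "?P S" for S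
  proof -
    have "S \<subseteq> W" using that by simp
    then have "lin_indpt S" and "S \<subseteq> carrier V"
      using that span_li_not_depend(2)[OF _ sub] WV by auto
    then show ?thesis
      using li_le_dim[OF \<open>fin_dim\<close>] by blast
  qed
  moreover have "?P {}"
    by (simp add: W.lin_dep_def)
  ultimately obtain S where "finite S" "maximal S ?P"
    using maximal_exists[of ?P dim "{}"] by blast
  then show ?thesis
    using W.max_li_is_gen[of S] unfolding W.fin_dim_def maximal_def by blast
qed

context symplectic_lie_algebra
begin

lemma form_skew:
  assumes "x \<in> carrier G" "y \<in> carrier G"
  shows "form G x y = \<ominus>\<^bsub>K\<^esub> form G y x"
proof -
  have "\<zero>\<^bsub>K\<^esub> = form G (x \<oplus>\<^bsub>G\<^esub> y) (x \<oplus>\<^bsub>G\<^esub> y)"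
    using assms by (simp add: form_self)
  also have "\<dots> = form G x y \<oplus>\<^bsub>K\<^esub> form G y x"
    using assms
    by (simp add: form_add_left form_add_right form_closed R.a_comm
        form_self[OF assms(1)] form_self[OF assms(2)])
  finally show ?thesis
    using assms form_closed by (metis R.minus_equality)
qed

lemma form_zero_sym:
  assumes "x \<in> carrier G" "y \<in> carrier G"
  shows "form G x y = \<zero>\<^bsub>K\<^esub> \<longleftrightarrow> form G y x = \<zero>\<^bsub>K\<^esub>"
  using form_skew[OF assms] form_skew[OF assms(2,1)] by auto

lemma form_zero_left: "y \<in> carrier G \<Longrightarrow> form G \<zero>\<^bsub>G\<^esub> y = \<zero>\<^bsub>K\<^esub>"
  using form_smult_left[of "\<zero>\<^bsub>K\<^esub>" "\<zero>\<^bsub>G\<^esub>" y] form_closed by simp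

lemma form_minus_left:
  assumes "x \<in> carrier G" "y \<in> carrier G" "z \<in> carrier G"
  shows "form G (x \<ominus>\<^bsub>G\<^esub> y) z = form G x z \<ominus>\<^bsub>K\<^esub> form G y z"
proof -
  have "form G (x \<ominus>\<^bsub>G\<^esub> y \<oplus>\<^bsub>G\<^esub> y) z = form G (x \<ominus>\<^bsub>G\<^esub> y) z \<oplus>\<^bsub>K\<^esub> form G y z"
    using assms by (intro form_add_left) auto
  moreover have "x \<ominus>\<^bsub>G\<^esub> y \<oplus>\<^bsub>G\<^esub> y = x"
    using assms by (simp add: a_minus_def M.a_assoc M.l_neg)
  ultimately show ?thesis
    using assms form_closed by (simp add: a_minus_def R.a_assoc R.r_neg)
qed

lemma form_minus_right:
  assumes "x \<in> carrier G" "y \<in> carrier G" "z \<in> carrier G"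
  shows "form G z (x \<ominus>\<^bsub>G\<^esub> y) = form G z x \<ominus>\<^bsub>K\<^esub> form G z y"
proof -
  have "form G z (x \<ominus>\<^bsub>G\<^esub> y \<oplus>\<^bsub>G\<^esub> y) = form G z (x \<ominus>\<^bsub>G\<^esub> y) \<oplus>\<^bsub>K\<^esub> form G z y"
    using assms by (intro form_add_right) auto
  moreover have "x \<ominus>\<^bsub>G\<^esub> y \<oplus>\<^bsub>G\<^esub> y = x"
    using assms by (simp add: a_minus_def M.a_assoc M.l_neg)
  ultimately show ?thesis
    using assms form_closed by (simp add: a_minus_def R.a_assoc R.r_neg)
qed

lemma minus_eq_zeroD:
  assumes "x \<in> carrier G" "y \<in> carrier G" "x \<ominus>\<^bsub>G\<^esub> y = \<zero>\<^bsub>G\<^esub>"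
  shows "x = y"
proof -
  have "x = x \<ominus>\<^bsub>G\<^esub> y \<oplus>\<^bsub>G\<^esub> y"
    using assms(1,2) by (simp add: a_minus_def M.a_assoc M.l_neg)
  then show ?thesis
    using assms by simp
qed

lemma eq_if_form_eq:
  assumes x: "x \<in> carrier G" and y: "y \<in> carrier G"
    and eq: "\<And>z. z \<in> carrier G \<Longrightarrow> form G x z = form G y z"
  shows "x = y"
proof -
  have "form G (x \<ominus>\<^bsub>G\<^esub> y) z = \<zero>\<^bsub>K\<^esub>" if "z \<in> carrier G" for z
    using form_minus_left[OF x y that] eq[OF that] form_closed[OF y that]
    by (simp add: a_minus_def R.r_neg)
  then have "x \<ominus>\<^bsub>G\<^esub> y = \<zero>\<^bsub>G\<^esub>"
    using x y by (intro form_nondegenerate) auto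
  then show ?thesis
    using x y minus_eq_zeroD by blast
qed

lemma submodule_minus_closed:
  assumes "submodule K W G" "x \<in> W" "y \<in> W"
  shows "x \<ominus>\<^bsub>G\<^esub> y \<in> W"
proof -
  interpret W: submodule K W G by fact
  have "\<ominus>\<^bsub>G\<^esub> y \<in> W"
    using W.smult_closed[of "\<ominus>\<^bsub>K\<^esub> \<one>\<^bsub>K\<^esub>" y] assms(3) W.subset
    by (metis R.a_inv_closed R.one_closed smult_minus_1 subsetD)
  then show ?thesis
    using assms(2) by (simp add: a_minus_def)
qed

lemma perp_submodule:
  assumes "W \<subseteq> carrier G"
  shows "submodule K (perp K G W) G"
proof
  show "perp K G W \<subseteq> carrier G" by (auto simp: perp_def)
qed (use assms in \<open>auto simp: perp_def form_zero_left form_add_left form_smult_left subset_iff\<close>)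

text \<open>The elements of \<open>S\<close> are treated one at a time: each either imposes no new
  condition on \<open>A\<close> or lets \<open>v\<close> be corrected by a multiple of it. In
  effect, \<open>(A \<inter> S\<^sup>\<bottom>)\<^sup>\<bottom>\<close> lies in
  \<open>A\<^sup>\<bottom> + B\<close>.\<close>

lemma annihilator_inter_finite_perp:
  assumes "finite S" and "submodule K A G" and "submodule K B G" and "S \<subseteq> B"
    and "v \<in> carrier G"
    and "\<And>u. u \<in> A \<Longrightarrow> u \<in> perp K G S \<Longrightarrow> form G u v = \<zero>\<^bsub>K\<^esub>"
  shows "\<exists>b\<in>B. v \<ominus>\<^bsub>G\<^esub> b \<in> perp K G A"
  using assms(1,4-6)
proof (induction S arbitrary: v rule: finite_induct)
  interpret A: submodule K A G by fact
  interpret B: submodule K B G by fact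
  case empty
  \<comment> \<open>The complement of the empty set is all of \<open>G\<close>, so \<open>v\<close>
    is already orthogonal to \<open>A\<close>, and zero serves as \<open>b\<close>.\<close>
  have "v \<ominus>\<^bsub>G\<^esub> \<zero>\<^bsub>G\<^esub> = v"
    using empty.prems(2) M.r_neg[OF M.zero_closed] by (simp add: a_minus_def)
  moreover have "v \<in> perp K G A"
    using empty.prems A.subset form_zero_sym by (auto simp: perp_def subset_iff)
  ultimately have "v \<ominus>\<^bsub>G\<^esub> \<zero>\<^bsub>G\<^esub> \<in> perp K G A"
    by simp
  then show ?case by (meson B.zero_closed)
next
  interpret A: submodule K A G by fact
  interpret B: submodule K B G by fact
  case (insert s S)
  have S: "S \<subseteq> carrier G" and s: "s \<in> carrier G" and sB: "s \<in> B"
    using insert.prems(1) B.subset by auto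
  interpret P: submodule K "perp K G S" G
    using S by (rule perp_submodule)
  show ?case
  proof (cases "\<forall>u \<in> A \<inter> perp K G S. form G u s = \<zero>\<^bsub>K\<^esub>")
    case True
    \<comment> \<open>Here \<open>A\<close> meets the complements of \<open>S\<close> and of
      \<open>insert s S\<close> in the same set, so the hypothesis on \<open>v\<close> holds for
      \<open>S\<close>.\<close>
    then show ?thesis
      using insert.prems by (intro insert.IH) (auto simp: perp_def)
  next
    case False
    then obtain e0 where e0: "e0 \<in> A" "e0 \<in> perp K G S" "form G e0 s \<noteq> \<zero>\<^bsub>K\<^esub>"
      by blast
    have e0G: "e0 \<in> carrier G" using e0(1) A.subset by blast
    have cK: "form G e0 s \<in> carrier K" using form_closed e0G s by blast
    have inv: "inv\<^bsub>K\<^esub> (form G e0 s) \<in> carrier K" "inv\<^bsub>K\<^esub> (form G e0 s) \<otimes>\<^bsub>K\<^esub> form G e0 s = \<one>\<^bsub>K\<^esub>"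
      using e0(3) cK field_Units by auto
    \<comment> \<open>Scaling gives \<open>form G e s\<close> the value one, so subtracting
      \<open>form G u s\<close> times \<open>e\<close> from \<open>u\<close> makes it orthogonal to
      \<open>s\<close>.\<close>
    define e where "e = inv\<^bsub>K\<^esub> (form G e0 s) \<odot>\<^bsub>G\<^esub> e0"
    have eA: "e \<in> A" and eS: "e \<in> perp K G S" and e: "e \<in> carrier G"
      using e0 inv e0G unfolding e_def by auto
    have es: "form G e s = \<one>\<^bsub>K\<^esub>"
      using inv e0G s by (simp add: e_def form_smult_left)
    define c where "c = form G e v"
    have c: "c \<in> carrier K" using e insert.prems(2) form_closed by (simp add: c_def)
    \<comment> \<open>The coefficient \<open>c\<close> makes \<open>w\<close> orthogonal to
      \<open>e\<close>; this is what brings \<open>w\<close> under the induction hypothesis for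
      \<open>S\<close>.\<close>
    define w where "w = v \<ominus>\<^bsub>G\<^esub> c \<odot>\<^bsub>G\<^esub> s"
    have w: "w \<in> carrier G"
      using insert.prems(2) c s by (simp add: w_def)
    have "form G u w = \<zero>\<^bsub>K\<^esub>" if u: "u \<in> A" "u \<in> perp K G S" for u
    proof -
      have uG: "u \<in> carrier G" using u(1) A.subset by blast
      define d where "d = form G u s"
      have d: "d \<in> carrier K" using uG s form_closed by (simp add: d_def)
      \<comment> \<open>\<open>?u\<close> is orthogonal to \<open>insert s S\<close>, hence to
        \<open>v\<close>. So \<open>form G u v\<close> is \<open>d\<close> times \<open>c\<close>,
        which the multiple of \<open>s\<close> in \<open>w\<close> cancels.\<close>
      let ?u = "u \<ominus>\<^bsub>G\<^esub> d \<odot>\<^bsub>G\<^esub> e"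
      have "?u \<in> A" "?u \<in> perp K G S"
        using submodule_minus_closed[OF assms(2) u(1)] submodule_minus_closed[OF perp_submodule[OF S] u(2)]
          d eA eS by auto
      moreover have "form G ?u s = \<zero>\<^bsub>K\<^esub>"
        using form_minus_left[OF uG _ s, of "d \<odot>\<^bsub>G\<^esub> e"] d e s es
        by (simp add: form_smult_left d_def[symmetric] a_minus_def R.r_neg)
      ultimately have "form G ?u v = \<zero>\<^bsub>K\<^esub>"
        using insert.prems(3)[of ?u] by (auto simp: perp_def)
      then have "form G u v \<ominus>\<^bsub>K\<^esub> d \<otimes>\<^bsub>K\<^esub> c = \<zero>\<^bsub>K\<^esub>"
        using form_minus_left[OF uG _ insert.prems(2), of "d \<odot>\<^bsub>G\<^esub> e"] d e insert.prems(2)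
        by (simp add: form_smult_left c_def)
      then show ?thesis
        using form_minus_right[OF insert.prems(2) _ uG, of "c \<odot>\<^bsub>G\<^esub> s"] c s uG d
        by (simp add: w_def form_smult_right d_def[symmetric] R.m_comm)
    qed
    then obtain b where b: "b \<in> B" "w \<ominus>\<^bsub>G\<^esub> b \<in> perp K G A"
      using insert.IH[OF _ w] insert.prems(1) by blast
    have "b \<in> carrier G" using b(1) B.subset by blast
    then have "w \<ominus>\<^bsub>G\<^esub> b = v \<ominus>\<^bsub>G\<^esub> (c \<odot>\<^bsub>G\<^esub> s \<oplus>\<^bsub>G\<^esub> b)"
      using insert.prems(2) c s
      by (simp add: w_def a_minus_def M.minus_add M.a_assoc)
    moreover have "c \<odot>\<^bsub>G\<^esub> s \<oplus>\<^bsub>G\<^esub> b \<in> B"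
      using c sB b(1) by auto
    ultimately show ?thesis using b(2) by metis
  qed
qed

text \<open>Finite dimension enters here through a finite generating set \<open>S\<close> of
  \<open>B\<close>: the complement of a single vector is a subspace, so it contains \<open>B\<close>
  once it contains \<open>S\<close>.\<close>

lemma perp_eq_perp_finite:
  assumes "submodule K B G"
  shows "\<exists>S. finite S \<and> S \<subseteq> B \<and> perp K G S = perp K G B"
proof -
  interpret B: submodule K B G by fact
  have sub: "subspace K B G"
    using assms by (simp add: subspace_def vectorspace_axioms)
  interpret BV: vectorspace K "vs B"
    using sub by (rule subspace_is_vs)
  obtain S where S: "finite S" "S \<subseteq> B" "BV.span S = B"
    using subspace_fin_dim[OF finite_dim sub] unfolding BV.fin_dim_def by auto
  then have span: "span S = B"
    using span_li_not_depend(1)[OF S(2) assms] by simp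
  have "v \<in> perp K G B" if "v \<in> perp K G S" for v
  proof -
    have v: "v \<in> carrier G" using that by (simp add: perp_def)
    have "S \<subseteq> perp K G {v}"
      using that v S(2) B.subset form_zero_sym by (auto simp: perp_def subset_iff)
    then have "B \<subseteq> perp K G {v}"
      using span_is_subset[of S] perp_submodule[of "{v}"] v span by blast
    then show ?thesis
      using v form_zero_sym by (auto simp: perp_def subset_iff)
  qed
  moreover have "perp K G B \<subseteq> perp K G S"
    using S(2) by (auto simp: perp_def)
  ultimately show ?thesis
    using S(1,2) by blast
qed

text \<open>Replacing \<open>B\<close> by a finite subset with the same complement gives the
  substantial half of \<open>(A \<inter> B\<^sup>\<bottom>)\<^sup>\<bottom> = A\<^sup>\<bottom> +
  B\<close>.\<close>

lemma annihilator_inter_perp: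
  assumes "submodule K A G" and "submodule K B G" and "v \<in> carrier G"
    and "\<And>u. u \<in> A \<Longrightarrow> u \<in> perp K G B \<Longrightarrow> form G u v = \<zero>\<^bsub>K\<^esub>"
  shows "\<exists>b\<in>B. v \<ominus>\<^bsub>G\<^esub> b \<in> perp K G A"
  using perp_eq_perp_finite[OF assms(2)] annihilator_inter_finite_perp[of _ A B v] assms by metis

text \<open>With all of \<open>G\<close> as \<open>A\<close> in
  \<open>annihilator_inter_perp\<close>, the complement of \<open>A\<close> is zero by
  non-degeneracy. This yields
  \<open>B\<^sup>\<bottom>\<^sup>\<bottom> \<subseteq> B\<close>.\<close>

lemma in_if_perp_perp:
  assumes "submodule K B G" and v: "v \<in> carrier G"
    and "\<And>u. u \<in> perp K G B \<Longrightarrow> form G u v = \<zero>\<^bsub>K\<^esub>"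
  shows "v \<in> B"
proof -
  have "submodule K (carrier G) G"
    by unfold_locales auto
  then obtain b where b: "b \<in> B" "v \<ominus>\<^bsub>G\<^esub> b \<in> perp K G (carrier G)"
    using annihilator_inter_perp[of "carrier G" B v] assms by blast
  then have "v \<ominus>\<^bsub>G\<^esub> b = \<zero>\<^bsub>G\<^esub>"
    using form_nondegenerate by (auto simp: perp_def)
  then show ?thesis
    using b(1) v assms(1) minus_eq_zeroD[of v b] by (auto simp: submodule_def)
qed

end


section \<open>Form-preserving homomorphisms on subalgebras\<close>

definition lie_subalgebra ::
    "('k, 'm) ring_scheme \<Rightarrow> ('k, 'a, 'n) lie_alg_scheme \<Rightarrow> 'a set \<Rightarrow> bool" where
  "lie_subalgebra K L D \<longleftrightarrow> submodule K D L \<and> (\<forall>x \<in> D. \<forall>y \<in> D. bracket L x y \<in> D)"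

text \<open>The domain is a subset \<open>D\<close> of \<open>G\<close> because a quotient map lives
  on \<open>perp K G J\<close> only; values outside \<open>D\<close> are left open.\<close>

definition symplectic_map ::
    "('k, 'm) ring_scheme \<Rightarrow> 'a set \<Rightarrow> ('k, 'a, 'n) symp_alg_scheme \<Rightarrow>
      ('k, 'b, 'p) symp_alg_scheme \<Rightarrow> ('a \<Rightarrow> 'b) \<Rightarrow> bool" where
  "symplectic_map K D G H f \<longleftrightarrow>
     f ` D \<subseteq> carrier H \<and>
     (\<forall>x \<in> D. \<forall>y \<in> D. f (x \<oplus>\<^bsub>G\<^esub> y) = f x \<oplus>\<^bsub>H\<^esub> f y) \<and>
     (\<forall>a \<in> carrier K. \<forall>x \<in> D. f (a \<odot>\<^bsub>G\<^esub> x) = a \<odot>\<^bsub>H\<^esub> f x) \<and>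
     (\<forall>x \<in> D. \<forall>y \<in> D. f (bracket G x y) = bracket H (f x) (f y)) \<and>
     (\<forall>x \<in> D. \<forall>y \<in> D. form H (f x) (f y) = form G x y)"

lemma symplectic_mapD:
  assumes "symplectic_map K D G H f"
  shows "x \<in> D \<Longrightarrow> f x \<in> carrier H"
    and "x \<in> D \<Longrightarrow> y \<in> D \<Longrightarrow> f (x \<oplus>\<^bsub>G\<^esub> y) = f x \<oplus>\<^bsub>H\<^esub> f y"
    and "a \<in> carrier K \<Longrightarrow> x \<in> D \<Longrightarrow> f (a \<odot>\<^bsub>G\<^esub> x) = a \<odot>\<^bsub>H\<^esub> f x"
    and "x \<in> D \<Longrightarrow> y \<in> D \<Longrightarrow> f (bracket G x y) = bracket H (f x) (f y)"
    and "x \<in> D \<Longrightarrow> y \<in> D \<Longrightarrow> form H (f x) (f y) = form G x y"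
  using assms by (auto simp: symplectic_map_def)

lemma symplectic_map_mono:
  "symplectic_map K D G H f \<Longrightarrow> E \<subseteq> D \<Longrightarrow> symplectic_map K E G H f"
  unfolding symplectic_map_def image_subset_iff subset_iff by blast

lemma symplectic_map_comp:
  assumes f: "symplectic_map K D G H f" and g: "symplectic_map K E H M g" and "f ` D \<subseteq> E"
  shows "symplectic_map K D G M (g \<circ> f)"
proof -
  have fE: "f x \<in> E" if "x \<in> D" for x
    using that assms(3) by blast
  show ?thesis
    unfolding symplectic_map_def
    using fE by (simp add: image_subset_iff symplectic_mapD[OF f] symplectic_mapD[OF g])
qed

lemma symplectic_map_zero:
  assumes "symplectic_lie_algebra K G" and "symplectic_lie_algebra K H"
    and f: "symplectic_map K D G H f" and D: "submodule K D G"
  shows "f \<zero>\<^bsub>G\<^esub> = \<zero>\<^bsub>H\<^esub>"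
proof -
  interpret G: symplectic_lie_algebra K G by fact
  interpret H: symplectic_lie_algebra K H by fact
  interpret D: submodule K D G by fact
  have "f (\<zero>\<^bsub>K\<^esub> \<odot>\<^bsub>G\<^esub> \<zero>\<^bsub>G\<^esub>) = \<zero>\<^bsub>K\<^esub> \<odot>\<^bsub>H\<^esub> f \<zero>\<^bsub>G\<^esub>"
    using D.zero_closed G.R.zero_closed by (intro symplectic_mapD(3)[OF f])
  then show ?thesis
    using symplectic_mapD(1)[OF f D.zero_closed] by simp
qed

text \<open>Since \<open>f\<close> is onto and preserves forms, \<open>f x\<close> and
  \<open>f y\<close> pair equally with all of \<open>H\<close>, and non-degeneracy of
  \<open>H\<close> identifies them. This takes the place of kernel computations.\<close>

lemma symplectic_map_eqI:
  assumes "symplectic_lie_algebra K H" and f: "symplectic_map K D G H f" and "f ` D = carrier H"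
    and xy: "x \<in> D" "y \<in> D" and "\<And>z. z \<in> D \<Longrightarrow> form G x z = form G y z"
  shows "f x = f y"
proof -
  interpret H: symplectic_lie_algebra K H by fact
  show ?thesis
  proof (rule H.eq_if_form_eq)
    fix w assume "w \<in> carrier H"
    then obtain z where "z \<in> D" "w = f z" using assms(3) by blast
    then show "form H (f x) w = form H (f y) w"
      using symplectic_mapD(5)[OF f] xy assms(6) by simp
  qed (use symplectic_mapD(1)[OF f] xy in auto)
qed

text \<open>Elements with the same image pair equally with everything, so non-degeneracy of the
  source identifies them.\<close>

lemma symplectic_map_inj:
  assumes "symplectic_lie_algebra K G" and f: "symplectic_map K (carrier G) G H f"
  shows "inj_on f (carrier G)"
proof
  interpret G: symplectic_lie_algebra K G by fact
  fix x y assume xy: "x \<in> carrier G" "y \<in> carrier G" "f x = f y"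
  show "x = y"
    using xy(1,2)
  proof (rule G.eq_if_form_eq)
    fix z assume "z \<in> carrier G"
    then show "form G x z = form G y z"
      using symplectic_mapD(5)[OF f] xy by metis
  qed
qed

lemma symplectic_iso_if_surj_map:
  assumes "symplectic_lie_algebra K G" and f: "symplectic_map K (carrier G) G H f"
    and "f ` carrier G = carrier H"
  shows "symplectic_iso K G H f"
  using symplectic_mapD[OF f] symplectic_map_inj[OF assms(1) f] assms(3)
  by (auto simp: symplectic_iso_def module_hom_def bij_betw_def)

text \<open>
  Non-degeneracy of the form on \<open>M\<close> makes \<open>g\<close> constant on the fibres of \<open>f\<close>.
\<close>

lemma symplectic_map_factor:
  assumes "symplectic_lie_algebra K M" and D: "lie_subalgebra K G D"
    and f: "symplectic_map K D G H f"
    and g: "symplectic_map K D G M g" "g ` D = carrier M"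
  obtains h where "symplectic_map K (f ` D) H M h" and "\<And>x. x \<in> D \<Longrightarrow> h (f x) = g x"
proof
  define h where "h y = g (SOME x. x \<in> D \<and> f x = y)" for y
  show hf: "h (f x) = g x" if x: "x \<in> D" for x
  proof -
    define x' where "x' = (SOME x'. x' \<in> D \<and> f x' = f x)"
    have x': "x' \<in> D" "f x' = f x"
      using someI[of "\<lambda>x'. x' \<in> D \<and> f x' = f x", OF conjI[OF x refl]] by (auto simp: x'_def)
    have "g x' = g x"
      using assms(1) g x'(1) x
    proof (rule symplectic_map_eqI)
      fix z assume "z \<in> D"
      then show "form G x' z = form G x z"
        using symplectic_mapD(5)[OF f] x x' by metis
    qed
    then show ?thesis by (simp add: h_def x'_def)
  qed
  have D': "x \<oplus>\<^bsub>G\<^esub> y \<in> D" "a \<odot>\<^bsub>G\<^esub> x \<in> D" "bracket G x y \<in> D"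
    if "x \<in> D" "y \<in> D" "a \<in> carrier K" for x y a
    using D that by (auto simp: lie_subalgebra_def submodule_def)
  show "symplectic_map K (f ` D) H M h"
    unfolding symplectic_map_def ball_simps
  proof (intro conjI ballI)
    show "h ` f ` D \<subseteq> carrier M"
      using hf symplectic_mapD(1)[OF g(1)] by auto
    fix x assume x: "x \<in> D"
    show "h (a \<odot>\<^bsub>H\<^esub> f x) = a \<odot>\<^bsub>M\<^esub> h (f x)" if "a \<in> carrier K" for a
      using x that D' hf by (simp add: symplectic_mapD(3)[OF f, symmetric] symplectic_mapD[OF g(1)])
    fix y assume y: "y \<in> D"
    have [simp]: "x \<oplus>\<^bsub>G\<^esub> y \<in> D" "bracket G x y \<in> D"
      using D x y by (auto simp: lie_subalgebra_def submodule_def)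
    show "h (f x \<oplus>\<^bsub>H\<^esub> f y) = h (f x) \<oplus>\<^bsub>M\<^esub> h (f y)"
      "h (bracket H (f x) (f y)) = bracket M (h (f x)) (h (f y))"
      "form M (h (f x)) (h (f y)) = form H (f x) (f y)"
      using x y hf
      by (simp_all add: symplectic_mapD(2,4)[OF f, symmetric] symplectic_mapD(5)[OF f]
          symplectic_mapD[OF g(1)])
  qed
qed

text \<open>Equational axioms and finite dimension pass to the image of \<open>D\<close>, and
  \<open>radical\<close> supplies non-degeneracy. The hypothesis \<open>zero\<close> is there
  because the zero of \<open>H\<close> is a separate record field on which
  \<open>symplectic_map\<close> puts no condition.\<close>

lemma symplectic_lie_algebra_image:
  assumes "symplectic_lie_algebra K G" and D: "lie_subalgebra K G D"
    and f: "symplectic_map K D G H f" and surj: "f ` D = carrier H"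
    and zero: "f \<zero>\<^bsub>G\<^esub> = \<zero>\<^bsub>H\<^esub>"
    and radical: "\<And>x. x \<in> D \<Longrightarrow> (\<And>y. y \<in> D \<Longrightarrow> form G x y = \<zero>\<^bsub>K\<^esub>) \<Longrightarrow> f x = \<zero>\<^bsub>H\<^esub>"
  shows "symplectic_lie_algebra K H"
proof -
  interpret G: symplectic_lie_algebra K G by fact
  interpret D: submodule K D G
    using D by (simp add: lie_subalgebra_def)
  have DG: "x \<in> carrier G" if "x \<in> D" for x
    using D.subset that by blast
  have Dbr: "bracket G x y \<in> D" if "x \<in> D" "y \<in> D" for x y
    using D that by (simp add: lie_subalgebra_def)
  have neg: "\<ominus>\<^bsub>G\<^esub> x \<in> D" if "x \<in> D" for x
    using G.submodule_minus_closed[OF D.submodule_axioms D.zero_closed that] DG[OF that]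
    by (simp add: a_minus_def)
  note hom = symplectic_mapD(2-4)[OF f, symmetric] zero[symmetric] symplectic_mapD(5)[OF f]
  note closed = D.m_closed D.smult_closed Dbr D.zero_closed DG
  have vs: "vectorspace K H"
  proof (rule vs_criteria)
    show "field K" ..
    show "\<forall>v\<in>carrier H. \<exists>w\<in>carrier H. v \<oplus>\<^bsub>H\<^esub> w = \<zero>\<^bsub>H\<^esub>"
    proof
      fix v assume "v \<in> carrier H"
      then obtain x where x: "x \<in> D" "v = f x" using surj by blast
      have "v \<oplus>\<^bsub>H\<^esub> f (\<ominus>\<^bsub>G\<^esub> x) = \<zero>\<^bsub>H\<^esub>"
        using x neg[OF x(1)] DG[OF x(1)] by (simp add: hom G.M.r_neg)
      then show "\<exists>w\<in>carrier H. v \<oplus>\<^bsub>H\<^esub> w = \<zero>\<^bsub>H\<^esub>"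
        using neg[OF x(1)] surj by blast
    qed
  qed (unfold surj[symmetric], auto simp: hom closed G.M.a_ac G.smult_assoc1
      G.smult_l_distr G.smult_r_distr)
  interpret H: vectorspace K H by (rule vs)
  have sub: "subspace K D G"
    using D.submodule_axioms by (simp add: subspace_def G.vectorspace_axioms)
  interpret V: vectorspace K "G.vs D"
    using sub by (rule G.subspace_is_vs)
  interpret L: linear_map K "G.vs D" H f
    by unfold_locales (use symplectic_mapD(1-3)[OF f] in \<open>auto simp: module_hom_def\<close>)
  have fin: "H.fin_dim"
    using L.surj_fin_dim[OF G.subspace_fin_dim[OF G.finite_dim sub]] surj by simp
  show ?thesis
  proof unfold_locales
    show "H.fin_dim" by (rule fin)
    fix u assume u: "u \<in> carrier H" "\<And>v. v \<in> carrier H \<Longrightarrow> form H u v = \<zero>\<^bsub>K\<^esub>"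
    then obtain x where x: "x \<in> D" "u = f x" using surj by blast
    have "f x = \<zero>\<^bsub>H\<^esub>"
      using x(1)
    proof (rule radical)
      fix y assume y: "y \<in> D"
      then show "form G x y = \<zero>\<^bsub>K\<^esub>"
        using u(2)[of "f y"] symplectic_mapD(1,5)[OF f] x by simp
    qed
    then show "u = \<zero>\<^bsub>H\<^esub>" using x(2) by simp
  qed (unfold surj[symmetric], auto simp: hom closed G.bracket_add_left G.bracket_add_right
      G.bracket_smult_left G.bracket_smult_right G.bracket_self G.jacobi G.form_closed
      G.form_add_left G.form_add_right G.form_smult_left G.form_smult_right G.form_self
      G.form_closed_cocycle)
qed


section \<open>Isotropic ideals, their complements and their images\<close>

lemma isotropic_ideal_submodule: "isotropic_ideal K G J \<Longrightarrow> submodule K J G"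
  by (simp add: isotropic_ideal_def lie_ideal_def subspace_def)

lemma isotropic_ideal_bracket:
  "isotropic_ideal K G J \<Longrightarrow> x \<in> carrier G \<Longrightarrow> y \<in> J \<Longrightarrow> bracket G x y \<in> J"
  by (simp add: isotropic_ideal_def lie_ideal_def)

lemma isotropic_ideal_form:
  "isotropic_ideal K G J \<Longrightarrow> x \<in> J \<Longrightarrow> y \<in> J \<Longrightarrow> form G x y = \<zero>\<^bsub>K\<^esub>"
  by (auto simp: isotropic_ideal_def perp_def)

lemma isotropic_ideal_perp: "isotropic_ideal K G J \<Longrightarrow> J \<subseteq> perp K G J"
  by (simp add: isotropic_ideal_def)

lemma perp_subalgebra:
  assumes "symplectic_lie_algebra K G" and J: "isotropic_ideal K G J"
  shows "lie_subalgebra K G (perp K G J)"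
proof -
  interpret G: symplectic_lie_algebra K G by fact
  have "J \<subseteq> carrier G"
    using isotropic_ideal_submodule[OF J] by (simp add: submodule_def)
  then show ?thesis
    unfolding lie_subalgebra_def
    using G.perp_submodule reduction_ops(7)[OF assms, where a = "\<zero>\<^bsub>K\<^esub>"] by blast
qed

lemma isotropic_ideal_zero:
  assumes "symplectic_lie_algebra K G"
  shows "isotropic_ideal K G {\<zero>\<^bsub>G\<^esub>}" and "perp K G {\<zero>\<^bsub>G\<^esub>} = carrier G"
proof -
  interpret G: symplectic_lie_algebra K G by fact
  show perp: "perp K G {\<zero>\<^bsub>G\<^esub>} = carrier G"
    using G.form_zero_sym[of _ "\<zero>\<^bsub>G\<^esub>"] by (auto simp: perp_def G.form_zero_left)
  have "submodule K {\<zero>\<^bsub>G\<^esub>} G"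
    by unfold_locales auto
  moreover have "bracket G x \<zero>\<^bsub>G\<^esub> = \<zero>\<^bsub>G\<^esub>" if "x \<in> carrier G" for x
    using G.bracket_smult_right[of "\<zero>\<^bsub>K\<^esub>" x "\<zero>\<^bsub>G\<^esub>"] G.bracket_closed that by simp
  ultimately show "isotropic_ideal K G {\<zero>\<^bsub>G\<^esub>}"
    by (simp add: isotropic_ideal_def lie_ideal_def subspace_def perp G.vectorspace_axioms)
qed

text \<open>\<open>J \<inter> D\<close> is an ideal of the subalgebra \<open>D\<close>, and
  surjective homomorphisms carry ideals to ideals; isotropy survives because forms are
  preserved.\<close>

lemma isotropic_ideal_image:
  assumes "symplectic_lie_algebra K G" and "symplectic_lie_algebra K H"
    and D: "lie_subalgebra K G D"
    and f: "symplectic_map K D G H f" and surj: "f ` D = carrier H"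
    and J: "isotropic_ideal K G J"
  shows "isotropic_ideal K H (f ` (J \<inter> D))"
proof -
  interpret G: symplectic_lie_algebra K G by fact
  interpret H: symplectic_lie_algebra K H by fact
  interpret D: submodule K D G
    using D by (simp add: lie_subalgebra_def)
  interpret J: submodule K J G
    using J by (rule isotropic_ideal_submodule)
  have "submodule K (f ` (J \<inter> D)) H"
  proof
    show "f ` (J \<inter> D) \<subseteq> carrier H"
      using surj by blast
    show "\<zero>\<^bsub>H\<^esub> \<in> f ` (J \<inter> D)"
      using symplectic_map_zero[OF assms(1,2) f D.submodule_axioms, symmetric] by auto
    fix v assume "v \<in> f ` (J \<inter> D)"
    then obtain x where x: "x \<in> J" "x \<in> D" "v = f x" by blast
    show "a \<odot>\<^bsub>H\<^esub> v \<in> f ` (J \<inter> D)" if "a \<in> carrier K" for a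
      using x that by (simp add: symplectic_mapD(3)[OF f, symmetric])
    fix w assume "w \<in> f ` (J \<inter> D)"
    then obtain y where y: "y \<in> J" "y \<in> D" "w = f y" by blast
    show "v \<oplus>\<^bsub>H\<^esub> w \<in> f ` (J \<inter> D)"
      using x y by (simp add: symplectic_mapD(2)[OF f, symmetric])
  qed
  moreover have "bracket H v w \<in> f ` (J \<inter> D)" if v: "v \<in> carrier H" and w: "w \<in> f ` (J \<inter> D)" for v w
  proof -
    obtain x y where x: "x \<in> D" "v = f x" and y: "y \<in> J" "y \<in> D" "w = f y"
      using v w surj by blast
    have "bracket G x y \<in> J \<inter> D"
      using x y D J D.subset isotropic_ideal_bracket[OF J] by (auto simp: lie_subalgebra_def)
    then show ?thesis
      using x y by (simp add: symplectic_mapD(4)[OF f, symmetric])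
  qed
  moreover have "f ` (J \<inter> D) \<subseteq> perp K H (f ` (J \<inter> D))"
    using isotropic_ideal_form[OF J] surj by (auto simp: perp_def symplectic_mapD(5)[OF f])
  ultimately show ?thesis
    by (simp add: isotropic_ideal_def lie_ideal_def subspace_def H.vectorspace_axioms)
qed

section \<open>Reductions described by quotient maps\<close>

text \<open>
  The kernel of \<open>q\<close> need not be mentioned: since \<open>q\<close> preserves the forms, it is the radical
  \<open>J\<close> of the form on \<open>perp K G J\<close>.
\<close>

definition reduces ::
    "('k, 'm) ring_scheme \<Rightarrow> ('k, 'a) symp_alg \<Rightarrow> ('k, 'a) symp_alg \<Rightarrow> bool" where
  "reduces K G H \<longleftrightarrow> symplectic_lie_algebra K G \<and> symplectic_lie_algebra K H \<and>
     (\<exists>J q. isotropic_ideal K G J \<and> symplectic_map K (perp K G J) G H q \<and>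
       q ` perp K G J = carrier H)"

text \<open>The coset map followed by \<open>\<Phi>\<close> is the quotient map that
  \<open>reduces\<close> asks for. The last claim speaks of the image of zero because nothing ties
  the zero field of \<open>H\<close> to it.\<close>

lemma quotient_map_of_reduction_iso:
  assumes G: "symplectic_lie_algebra K G" and J: "isotropic_ideal K G J"
    and \<Phi>: "symplectic_iso K (symplectic_reduction K G J) H \<Phi>"
  defines "q \<equiv> \<lambda>v. \<Phi> (J +>\<^bsub>G\<^esub> v)"
  shows "symplectic_map K (perp K G J) G H q" and "q ` perp K G J = carrier H"
    and "x \<in> J \<Longrightarrow> q x = q \<zero>\<^bsub>G\<^esub>"
proof -
  interpret G: symplectic_lie_algebra K G by fact
  interpret J: submodule K J G
    using J by (rule isotropic_ideal_submodule)
  let ?Q = "symplectic_reduction K G J"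
  have carr: "carrier ?Q = (\<lambda>v. J +>\<^bsub>G\<^esub> v) ` perp K G J"
    by (simp add: symplectic_reduction_def)
  then show surj: "q ` perp K G J = carrier H"
    using \<Phi> by (auto simp: symplectic_iso_def bij_betw_def q_def image_image)
  have Q: "J +>\<^bsub>G\<^esub> v \<in> carrier ?Q" if "v \<in> perp K G J" for v
    using that carr by blast
  note ops = reduction_ops(1-4)[OF G J, symmetric]
  show "symplectic_map K (perp K G J) G H q"
    unfolding symplectic_map_def
  proof (intro conjI ballI)
    show "q ` perp K G J \<subseteq> carrier H" using surj by simp
    fix v assume v: "v \<in> perp K G J"
    show "q (a \<odot>\<^bsub>G\<^esub> v) = a \<odot>\<^bsub>H\<^esub> q v" if a: "a \<in> carrier K" for a
      using \<Phi> Q[OF v] a ops(2)[OF v v a] by (simp add: q_def symplectic_iso_def module_hom_def)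
    fix w assume w: "w \<in> perp K G J"
    note ops' = ops[OF v w G.R.zero_closed]
    show "q (v \<oplus>\<^bsub>G\<^esub> w) = q v \<oplus>\<^bsub>H\<^esub> q w" "q (bracket G v w) = bracket H (q v) (q w)"
      "form H (q v) (q w) = form G v w"
      using \<Phi> Q[OF v] Q[OF w] ops'(1,3,4) by (simp_all add: q_def symplectic_iso_def module_hom_def)
  qed
  have "subgroup J (add_monoid G)"
  proof (rule G.M.add.subgroupI)
    fix x assume "x \<in> J"
    then have "\<zero>\<^bsub>G\<^esub> \<ominus>\<^bsub>G\<^esub> x \<in> J" and "x \<in> carrier G"
      using G.submodule_minus_closed[OF J.submodule_axioms J.zero_closed] J.subset by auto
    then show "\<ominus>\<^bsub>G\<^esub> x \<in> J"
      by (simp add: a_minus_def)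
  qed (use J.subset J.zero_closed in \<open>auto simp del: J.zero_closed\<close>)
  then have "J +>\<^bsub>G\<^esub> y = J" if "y \<in> J" for y
    using that J.subset by (intro G.M.a_coset_join2) auto
  then show "q x = q \<zero>\<^bsub>G\<^esub>" if "x \<in> J"
    using that by (simp add: q_def)
qed

lemma reduces_if_is_symplectic_reduction:
  assumes "symplectic_lie_algebra K G" and "symplectic_lie_algebra K H"
    and "is_symplectic_reduction K G H"
  shows "reduces K G H"
  using assms quotient_map_of_reduction_iso(1,2)[OF assms(1)]
  unfolding reduces_def is_symplectic_reduction_def by blast

lemma reduction_exists:
  fixes G :: "('k, 'a) symp_alg"
  assumes G: "symplectic_lie_algebra K G" and J: "isotropic_ideal K G J"
  shows "\<exists>(H :: ('k, 'a) symp_alg) q. symplectic_lie_algebra K H \<and>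
    symplectic_map K (perp K G J) G H q \<and> q ` perp K G J = carrier H"
proof -
  interpret G: symplectic_lie_algebra K G by fact
  interpret J: submodule K J G
    using J by (rule isotropic_ideal_submodule)
  obtain H0 :: "('k, 'a) symp_alg" and \<Phi>
    where "symplectic_iso K (symplectic_reduction K G J) H0 \<Phi>"
    using reduction_copy_exists[OF assms] by blast
  note q0 = quotient_map_of_reduction_iso[OF assms this]
  define q where "q = (\<lambda>v. \<Phi> (J +>\<^bsub>G\<^esub> v))"
  \<comment> \<open>\<open>symplectic_iso\<close> leaves the zero field of the copy
    \<open>H0\<close> open, so it is reset to the image of zero.\<close>
  define H where "H = H0\<lparr>zero := q \<zero>\<^bsub>G\<^esub>\<rparr>"
  have q: "symplectic_map K (perp K G J) G H q" "q ` perp K G J = carrier H"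
    using q0(1,2) by (simp_all add: symplectic_map_def H_def q_def)
  have "symplectic_lie_algebra K H"
    using G perp_subalgebra[OF assms] q
  proof (rule symplectic_lie_algebra_image)
    show "q \<zero>\<^bsub>G\<^esub> = \<zero>\<^bsub>H\<^esub>" by (simp add: H_def)
    fix x assume x: "x \<in> perp K G J" "\<And>y. y \<in> perp K G J \<Longrightarrow> form G x y = \<zero>\<^bsub>K\<^esub>"
    \<comment> \<open>The radical of the form on \<open>J\<^sup>\<bottom>\<close> is contained in
      \<open>J\<^sup>\<bottom>\<^sup>\<bottom> = J\<close>, which \<open>q\<close> sends to
      zero.\<close>
    have "x \<in> J"
      using J.submodule_axioms
    proof (rule G.in_if_perp_perp)
      show "x \<in> carrier G" using x(1) by (simp add: perp_def)
      fix u assume u: "u \<in> perp K G J"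
      then show "form G u x = \<zero>\<^bsub>K\<^esub>"
        using x G.form_zero_sym[of u x] by (simp add: perp_def)
    qed
    from q0(3)[OF this] show "q x = \<zero>\<^bsub>H\<^esub>"
      by (simp add: H_def q_def)
  qed
  then show ?thesis using q by blast
qed

text \<open>
  With \<open>G1 = I\<^sup>\<bottom> / I\<close>, the preimage of the right-hand side is
  \<open>I\<^sup>\<bottom> \<inter> (J \<inter> I\<^sup>\<bottom>)\<^sup>\<bottom> = I\<^sup>\<bottom> \<inter> (J\<^sup>\<bottom> + I) = (I\<^sup>\<bottom> \<inter> J\<^sup>\<bottom>) + I\<close>, because \<open>I \<subseteq> I\<^sup>\<bottom>\<close>.
\<close>

lemma image_inter_perp:
  assumes G: "symplectic_lie_algebra K G" and H: "symplectic_lie_algebra K H"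
    and I: "isotropic_ideal K G I" and J: "isotropic_ideal K G J"
    and q: "symplectic_map K (perp K G I) G H q" "q ` perp K G I = carrier H"
  shows "q ` (perp K G I \<inter> perp K G J) = perp K H (q ` (J \<inter> perp K G I))"
proof
  interpret G: symplectic_lie_algebra K G by fact
  interpret I: submodule K I G
    using I by (rule isotropic_ideal_submodule)
  interpret J: submodule K J G
    using J by (rule isotropic_ideal_submodule)
  show "q ` (perp K G I \<inter> perp K G J) \<subseteq> perp K H (q ` (J \<inter> perp K G I))"
    by (auto simp: perp_def[of K H] perp_def[of K G J] symplectic_mapD(1,5)[OF q(1)])
  show "perp K H (q ` (J \<inter> perp K G I)) \<subseteq> q ` (perp K G I \<inter> perp K G J)"
  proof
    fix y assume y: "y \<in> perp K H (q ` (J \<inter> perp K G I))"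
    then obtain v where v: "v \<in> perp K G I" "y = q v"
      using q(2) by (auto simp: perp_def[of K H])
    have vG: "v \<in> carrier G" using v(1) by (simp add: perp_def)
    have "form G u v = \<zero>\<^bsub>K\<^esub>" if u: "u \<in> J" "u \<in> perp K G I" for u
    proof -
      have "form G v u = \<zero>\<^bsub>K\<^esub>"
        using y v u symplectic_mapD(5)[OF q(1) v(1) u(2)] by (auto simp: perp_def[of K H])
      then show ?thesis
        using u(1) J.subset vG G.form_zero_sym by blast
    qed
    then obtain b where b: "b \<in> I" "v \<ominus>\<^bsub>G\<^esub> b \<in> perp K G J"
      using G.annihilator_inter_perp[OF J.submodule_axioms I.submodule_axioms vG] by blast
    have bG: "b \<in> carrier G" using b(1) I.subset by blast
    have vb: "v \<ominus>\<^bsub>G\<^esub> b \<in> perp K G I"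
      using b(1) v(1) isotropic_ideal_perp[OF I] G.perp_submodule[OF I.subset]
        G.submodule_minus_closed by blast
    \<comment> \<open>The two arguments differ by an element of \<open>I\<close>, which pairs to
      zero with all of \<open>I\<^sup>\<bottom>\<close>.\<close>
    have "q (v \<ominus>\<^bsub>G\<^esub> b) = q v"
      using H q vb v(1)
    proof (rule symplectic_map_eqI)
      fix z assume z: "z \<in> perp K G I"
      then have "z \<in> carrier G" "form G b z = \<zero>\<^bsub>K\<^esub>"
        using b(1) bG G.form_zero_sym[of b z] by (auto simp: perp_def)
      then show "form G (v \<ominus>\<^bsub>G\<^esub> b) z = form G v z"
        using G.form_minus_left[OF vG bG] G.form_closed[OF vG] G.R.r_neg[OF G.R.zero_closed]
        by (simp add: a_minus_def)
    qed
    then show "y \<in> q ` (perp K G I \<inter> perp K G J)"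
      using v(2) vb b(2) by (metis IntI imageI)
  qed
qed

section \<open>The diamond property and confluence\<close>

lemma reduces_diamond:
  fixes G G1 G2 :: "('k, 'a) symp_alg"
  assumes "reduces K G G1" and "reduces K G G2"
  shows "\<exists>H. reduces K G1 H \<and> reduces K G2 H"
proof -
  obtain I q1 where G: "symplectic_lie_algebra K G" and G1: "symplectic_lie_algebra K G1"
    and I: "isotropic_ideal K G I"
    and q1: "symplectic_map K (perp K G I) G G1 q1" "q1 ` perp K G I = carrier G1"
    using assms(1) by (auto simp: reduces_def)
  obtain J q2 where G2: "symplectic_lie_algebra K G2" and J: "isotropic_ideal K G J"
    and q2: "symplectic_map K (perp K G J) G G2 q2" "q2 ` perp K G J = carrier G2"
    using assms(2) by (auto simp: reduces_def)
  \<comment> \<open>Both quotient maps are defined on \<open>D\<close>, and they send it onto the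
    complements of the isotropic ideals \<open>?I\<close> and \<open>?J\<close>.\<close>
  define D where "D = perp K G I \<inter> perp K G J"
  have D: "lie_subalgebra K G D"
    using perp_subalgebra[OF G I] perp_subalgebra[OF G J]
    by (auto simp: lie_subalgebra_def submodule_def D_def)
  let ?I = "q1 ` (J \<inter> perp K G I)" and ?J = "q2 ` (I \<inter> perp K G J)"
  have im1: "q1 ` D = perp K G1 ?I"
    unfolding D_def by (rule image_inter_perp[OF G G1 I J q1])
  have im2: "q2 ` D = perp K G2 ?J"
    unfolding D_def Int_commute[of "perp K G I"] by (rule image_inter_perp[OF G G2 J I q2])
  have iso1: "isotropic_ideal K G1 ?I"
    by (rule isotropic_ideal_image[OF G G1 perp_subalgebra[OF G I] q1 J])
  have iso2: "isotropic_ideal K G2 ?J"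
    by (rule isotropic_ideal_image[OF G G2 perp_subalgebra[OF G J] q2 I])
  \<comment> \<open>\<open>H\<close> is built from \<open>G1\<close> alone; composition with
    \<open>q1\<close> then presents it as an image of \<open>D\<close>.\<close>
  obtain H :: "('k, 'a) symp_alg" and p where H: "symplectic_lie_algebra K H"
    and p: "symplectic_map K (perp K G1 ?I) G1 H p" "p ` perp K G1 ?I = carrier H"
    using reduction_exists[OF G1 iso1] by blast
  have q2D: "symplectic_map K D G G2 q2"
    using q2(1) by (rule symplectic_map_mono) (simp add: D_def)
  have "symplectic_map K D G G1 q1"
    using q1(1) by (rule symplectic_map_mono) (simp add: D_def)
  then have g: "symplectic_map K D G H (p \<circ> q1)"
    using p(1) by (rule symplectic_map_comp) (simp add: im1)
  have surj: "(p \<circ> q1) ` D = carrier H"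
    unfolding image_comp[symmetric] im1 p(2) ..
  \<comment> \<open>Factoring the surjection from \<open>D\<close> through \<open>q2\<close> gives a
    map from the complement of \<open>?J\<close> onto \<open>H\<close>, so the same \<open>H\<close>
    is also a reduction of \<open>G2\<close>, with no second quotient to compare.\<close>
  obtain h where h: "symplectic_map K (q2 ` D) G2 H h" "\<And>x. x \<in> D \<Longrightarrow> h (q2 x) = (p \<circ> q1) x"
    using symplectic_map_factor[OF H D q2D g surj] by blast
  have "h ` q2 ` D = carrier H"
    using h(2) by (simp add: image_image surj[symmetric])
  then have "reduces K G2 H"
    using G2 H iso2 h(1) unfolding reduces_def im2 by blast
  moreover have "reduces K G1 H"
    using G1 H iso1 p unfolding reduces_def by blast
  ultimately show ?thesis by blast
qed

text \<open>Strong confluence allows many steps on one side and at most one on the other; the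
  diamond closes each fork with a single step on both.\<close>

lemma confluentp_reduces:
  fixes K :: "('k, 'm) ring_scheme"
  shows "confluentp (reduces K :: ('k, 'a) symp_alg \<Rightarrow> _)"
proof (rule strong_confluentp_imp_confluentp, rule strong_confluentpI)
  fix G G1 G2 :: "('k, 'a) symp_alg"
  assume "reduces K G G1" "reduces K G G2"
  then show "\<exists>H. (reduces K)\<^sup>*\<^sup>* G1 H \<and> (reduces K)\<^sup>=\<^sup>= G2 H"
    using reduces_diamond by blast
qed

section \<open>Isomorphisms and irreducible algebras\<close>

text \<open>Injectivity comes from \<open>symplectic_map_inj\<close> as soon as \<open>G\<close> is
  symplectic, so such surjections are then isomorphisms.\<close>

definition symplectic_isomorphic ::
    "('k, 'm) ring_scheme \<Rightarrow> ('k, 'a) symp_alg \<Rightarrow> ('k, 'a) symp_alg \<Rightarrow> bool" where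
  "symplectic_isomorphic K G H \<longleftrightarrow>
     (\<exists>f. symplectic_map K (carrier G) G H f \<and> f ` carrier G = carrier H)"

lemma carrier_subalgebra: "symplectic_lie_algebra K G \<Longrightarrow> lie_subalgebra K G (carrier G)"
  using perp_subalgebra isotropic_ideal_zero by metis

lemma symplectic_map_id: "symplectic_map K (carrier G) G G (\<lambda>x. x)"
  by (simp add: symplectic_map_def)

lemma symplectic_isomorphic_refl: "symplectic_isomorphic K G G"
  unfolding symplectic_isomorphic_def using symplectic_map_id[of K G] by fastforce

lemma symplectic_isomorphic_trans:
  assumes "symplectic_isomorphic K G H" and "symplectic_isomorphic K H M"
  shows "symplectic_isomorphic K G M"
proof -
  obtain f g where f: "symplectic_map K (carrier G) G H f" "f ` carrier G = carrier H"
    and g: "symplectic_map K (carrier H) H M g" "g ` carrier H = carrier M"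
    using assms by (auto simp: symplectic_isomorphic_def)
  have "symplectic_map K (carrier G) G M (g \<circ> f)"
    by (rule symplectic_map_comp[OF f(1) g(1)]) (simp add: f(2))
  moreover have "(g \<circ> f) ` carrier G = carrier M"
    unfolding image_comp[symmetric] f(2) g(2) ..
  ultimately show ?thesis
    unfolding symplectic_isomorphic_def by blast
qed

lemma symplectic_isomorphic_sym:
  assumes G: "symplectic_lie_algebra K G" and "symplectic_isomorphic K G H"
  shows "symplectic_isomorphic K H G"
proof -
  obtain f where f: "symplectic_map K (carrier G) G H f" "f ` carrier G = carrier H"
    using assms(2) by (auto simp: symplectic_isomorphic_def)
  \<comment> \<open>Factoring the identity of \<open>G\<close> through \<open>f\<close> produces the
    inverse of \<open>f\<close>.\<close>
  obtain h where "symplectic_map K (f ` carrier G) H G h" "\<And>x. x \<in> carrier G \<Longrightarrow> h (f x) = x"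
    using symplectic_map_factor[OF G carrier_subalgebra[OF G] f(1) symplectic_map_id] by auto
  then show ?thesis
    unfolding symplectic_isomorphic_def f(2)[symmetric] by (force simp: image_image)
qed

text \<open>An inverse isomorphism carries an isotropic ideal of \<open>H\<close> to one of
  \<open>G\<close>, which is zero; injectivity brings this back to \<open>H\<close>.\<close>

lemma irreducible_symplectic_isomorphic:
  assumes "irreducible_symplectic K G" and H: "symplectic_lie_algebra K H"
    and "symplectic_isomorphic K G H"
  shows "irreducible_symplectic K H"
  unfolding irreducible_symplectic_def
proof (intro conjI allI impI H)
  have G: "symplectic_lie_algebra K G"
    using assms(1) by (simp add: irreducible_symplectic_def)
  obtain f where f: "symplectic_map K (carrier H) H G f" "f ` carrier H = carrier G"
    using symplectic_isomorphic_sym[OF G assms(3)] by (auto simp: symplectic_isomorphic_def)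
  fix J assume J: "isotropic_ideal K H J"
  have sub: "J \<subseteq> carrier H" "\<zero>\<^bsub>H\<^esub> \<in> J"
    using isotropic_ideal_submodule[OF J] by (auto simp: submodule_def)
  have "isotropic_ideal K G (f ` (J \<inter> carrier H))"
    by (rule isotropic_ideal_image[OF H G carrier_subalgebra[OF H] f J])
  then have "f ` (J \<inter> carrier H) = {\<zero>\<^bsub>G\<^esub>}"
    using assms(1) by (simp add: irreducible_symplectic_def)
  then have "f ` J = {\<zero>\<^bsub>G\<^esub>}"
    using sub(1) by (simp add: Int_absorb2)
  then have "f x = f \<zero>\<^bsub>H\<^esub>" if "x \<in> J" for x
    using that sub(2) by (metis imageI singletonD)
  then show "J = {\<zero>\<^bsub>H\<^esub>}"
    using symplectic_map_inj[OF H f(1)] sub unfolding inj_on_def by blast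
qed

text \<open>Only the zero ideal is available, and its complement is the whole algebra, so the
  quotient map is itself an isomorphism.\<close>

lemma irreducible_reduces:
  assumes "irreducible_symplectic K B" and "reduces K B H"
  shows "symplectic_isomorphic K B H" and "irreducible_symplectic K H"
proof -
  have B: "symplectic_lie_algebra K B"
    using assms(1) by (simp add: irreducible_symplectic_def)
  obtain J q where J: "isotropic_ideal K B J" and H: "symplectic_lie_algebra K H"
    and q: "symplectic_map K (perp K B J) B H q" "q ` perp K B J = carrier H"
    using assms(2) by (auto simp: reduces_def)
  have "J = {\<zero>\<^bsub>B\<^esub>}"
    using assms(1) J by (simp add: irreducible_symplectic_def)
  then show iso: "symplectic_isomorphic K B H"
    using q isotropic_ideal_zero(2)[OF B] by (auto simp: symplectic_isomorphic_def)
  show "irreducible_symplectic K H"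
    by (rule irreducible_symplectic_isomorphic[OF assms(1) H iso])
qed

text \<open>Irreducibility is carried through the induction because it makes the next step an
  isomorphism as well.\<close>

lemma irreducible_reduces_rtranclp:
  assumes "(reduces K)\<^sup>*\<^sup>* B H" and "irreducible_symplectic K B"
  shows "symplectic_isomorphic K B H \<and> irreducible_symplectic K H"
  using assms
proof (induction rule: rtranclp_induct)
  case base
  then show ?case by (simp add: symplectic_isomorphic_refl)
next
  case (step M H)
  then show ?case
    using irreducible_reduces[of K M H] symplectic_isomorphic_trans by blast
qed

section \<open>From reduction sequences to uniqueness of the base\<close>

lemma reduction_sequence_reduces:
  "reduction_sequence K Gs \<Longrightarrow> (reduces K)\<^sup>*\<^sup>* (hd Gs) (last Gs)"
proof (induction Gs rule: induct_list012)
  case (3 G H Gs)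
  then have "(reduces K)\<^sup>*\<^sup>* H (last (H # Gs))" and "reduces K G H"
    by (auto simp: reduction_sequence_def intro: reduces_if_is_symplectic_reduction)
  then show ?case
    by (simp add: converse_rtranclp_into_rtranclp)
qed (auto simp: reduction_sequence_def)

theorem theorem3p4:
  fixes K :: "('k, 'm) ring_scheme"
    and G B B' :: "('k, 'a) symp_alg"
  assumes "symplectic_lie_algebra K G"
    and "irreducible_symplectic_base K G B"
    and "irreducible_symplectic_base K G B'"
  shows "\<exists>\<Phi>. symplectic_iso K B B' \<Phi>"
proof -
  have irr: "irreducible_symplectic K B" "irreducible_symplectic K B'"
    and GB: "(reduces K)\<^sup>*\<^sup>* G B" "(reduces K)\<^sup>*\<^sup>* G B'"
    using assms(2,3) by (auto simp: irreducible_symplectic_base_def dest: reduction_sequence_reduces)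
  have symp: "symplectic_lie_algebra K B" "symplectic_lie_algebra K B'"
    using irr by (simp_all add: irreducible_symplectic_def)
  \<comment> \<open>Confluence yields a common reduct \<open>X\<close>; each irreducible base
    reaches it through isomorphisms only.\<close>
  obtain X where "(reduces K)\<^sup>*\<^sup>* B X" "(reduces K)\<^sup>*\<^sup>* B' X"
    using confluentpD[OF confluentp_reduces GB] by blast
  then have "symplectic_isomorphic K B X" "symplectic_isomorphic K X B'"
    using irreducible_reduces_rtranclp irr symplectic_isomorphic_sym[OF symp(2)] by blast+
  then have "symplectic_isomorphic K B B'"
    by (rule symplectic_isomorphic_trans)
  then show ?thesis
    using symplectic_iso_if_surj_map[OF symp(1)] by (auto simp: symplectic_isomorphic_def)
qed

end
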